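(* Let $H\in\mathbb{C}^{M\times M}$ be Hermitian, let $V\in\mathbb{C}^{M\times m}$ have full column rank, and put $S=V^\dagger V$, $H_K=V^\dagger HV$. Let $\widehat S=S+\Delta S$ and $\widehat H_K=H_K+\Delta H$ with $\Delta S,\Delta H\in\mathbb{C}^{m\times m}$, and let $G=S^{-1}H_K$ and $\widehat G=\widehat S^{-1}\widehat H_K$. If $\lVert S^{-1}\Delta S\rVert_2<1$, then $$\lVert\widehat G-G\rVert_2\le\frac{\lVert S^{-1}\rVert_2}{1-\lVert S^{-1}\Delta S\rVert_2}\Bigl(\lVert\Delta H\rVert_2+\lVert\Delta S\rVert_2\,\lVert G\rVert_2\Bigr).$$ Moreover, if $c$ and $\widehat c$ evolve from the same initial data $\widehat c(0)=c(0)\in\mathbb{C}^m$ under $i\dot c=Gc$ and $i\dot{\widehat c}=\widehat G\widehat c$, then for $t\ge0$ $$\lVert\widehat c(t)-c(t)\rVert_2\le t\sqrt{\kappa(S)\,\kappa(\widehat S)}\;\lVert\widehat G-G\rVert_2\,\lVert c(0)\rVert_2 .$$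
   Context: $\lVert\cdot\rVert_2$ denotes the Euclidean vector norm and the induced spectral matrix norm; $\dagger$ is the conjugate transpose; $\kappa(B)=\lVert B\rVert_2\lVert B^{-1}\rVert_2$ is the spectral condition number of an invertible matrix $B$. Since $V$ has full column rank, $S$ is positive definite. $\widehat S,\widehat H_K$ represent estimated versions (for example from Monte Carlo or quantum hardware sampling) of the overlap matrix $S$ and the projected Hamiltonian $H_K$, with estimation errors $\Delta S$ and $\Delta H$. The condition $\lVert S^{-1}\Delta S\rVert_2<1$ makes $\widehat S$ invertible, so $\widehat G$ is well defined.
   Formalization: The second (evolution) bound is proved only for Hermitian ΔS and ΔH; for arbitrary complex ones it is false (M=m=1, V=1, H=0, ΔS=0, ΔH=i gives e−1≤1 at t=1). *)

theory Defs
  imports "HOL-Analysis.Analysis"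
begin

text \<open>A matrix with rows indexed by \<open>'n\<close> and columns indexed by \<open>'m\<close> has type
  \<^typ>\<open>complex^'m^'n\<close>. The norm on \<^typ>\<open>complex^'m\<close> is the Euclidean one, so the operator
  norm below is the spectral norm.\<close>

definition conj_transpose :: "complex^'m^'n \<Rightarrow> complex^'n^'m" where
  "conj_transpose A = transpose (map_matrix cnj A)"

definition hermitian :: "complex^'m^'m \<Rightarrow> bool" where
  "hermitian A \<longleftrightarrow> conj_transpose A = A"

definition spectral_norm :: "complex^'m^'n \<Rightarrow> real" where
  "spectral_norm A = onorm ((*v) A)"

text \<open>Meaningful for invertible \<open>B\<close> only: \<^const>\<open>matrix_inv\<close> is unspecified otherwise.\<close>

definition spectral_cond :: "complex^'m^'m \<Rightarrow> real" where
  "spectral_cond B = spectral_norm B * spectral_norm (matrix_inv B)"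

text \<open>\<open>c\<close> is a differentiable solution of \<open>i c' = A c\<close> on \<open>[0, \<infinity>)\<close>, with a one-sided derivative
  at \<open>0\<close>. The values of \<open>c\<close> at negative times are irrelevant.\<close>

definition evolves_under :: "complex^'m^'m \<Rightarrow> (real \<Rightarrow> complex^'m) \<Rightarrow> bool" where
  "evolves_under A c \<longleftrightarrow>
     (\<forall>t\<ge>0. \<exists>c'. (c has_vector_derivative c') (at t within {0..}) \<and> \<i> *s c' = A *v c t)"

end

theory Submission
  imports Defs
begin

text \<open>The first bound follows from \<open>Ghat - G = Shat\<^sup>-\<^sup>1 (\<Delta>H - \<Delta>S G)\<close> and
  \<open>Shat = S (1 + S\<^sup>-\<^sup>1 \<Delta>S)\<close>. For the second, \<open>G\<close> is self-adjoint for the inner product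
  \<open>\<langle>x, S y\<rangle>\<close>, so the evolution of \<open>c\<close> preserves the norm that \<open>S\<close> induces, and likewise for \<open>Ghat\<close> and
  \<open>Shat\<close>, which is again positive definite. The error \<open>chat - c\<close> solves the perturbed equation with
  forcing \<open>(Ghat - G) c\<close>, hence grows at most linearly in the \<open>Shat\<close>-norm; comparing both induced
  norms with the Euclidean one costs the square roots of the condition numbers. Throughout,
  \<^const>\<open>inner\<close> on complex vectors is the real part of the Hermitian inner product, which suffices
  because all energies \<open>\<langle>x, S x\<rangle>\<close> are real.\<close>

section \<open>Matrices and the real inner product\<close>

text \<open>On \<open>complex\<close>, \<open>inner a b\<close> is the real part of
  \<open>cnj a * b\<close>, so an entry moves to the other argument as its conjugate.\<close>

lemma inner_matrix_vector_mult:
  fixes A :: "complex^'m^'n"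
  shows "inner x (A *v y) = inner (conj_transpose A *v x) y"
proof -
  have "inner x (A *v y) = (\<Sum>i\<in>UNIV. \<Sum>j\<in>UNIV. inner (x $ i) (A $ i $ j * y $ j))"
    by (simp add: inner_vec_def matrix_vector_mult_def inner_sum_right)
  also have "\<dots> = (\<Sum>j\<in>UNIV. \<Sum>i\<in>UNIV. inner (x $ i) (A $ i $ j * y $ j))"
    by (rule sum.swap)
  also have "\<dots> = (\<Sum>j\<in>UNIV. \<Sum>i\<in>UNIV. inner (cnj (A $ i $ j) * x $ i) (y $ j))"
    by (simp add: inner_complex_def algebra_simps)
  also have "\<dots> = inner (conj_transpose A *v x) y"
    by (simp add: inner_vec_def matrix_vector_mult_def inner_sum_left conj_transpose_def
        transpose_def map_matrix_def)
  finally show ?thesis .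
qed

lemma hermitian_inner:
  assumes "hermitian A"
  shows "inner x (A *v y) = inner (A *v x) y"
  using inner_matrix_vector_mult[of x A y] assms by (simp add: hermitian_def)

lemma conj_transpose_conj_transpose [simp]: "conj_transpose (conj_transpose A) = A"
  by (simp add: conj_transpose_def transpose_def map_matrix_def vec_eq_iff)

lemma conj_transpose_mult: "conj_transpose (A ** B) = conj_transpose B ** conj_transpose A"
  by (simp add: conj_transpose_def transpose_def map_matrix_def matrix_matrix_mult_def
      vec_eq_iff mult.commute)

lemma hermitian_add: "hermitian A \<Longrightarrow> hermitian B \<Longrightarrow> hermitian (A + B)"
  by (simp add: hermitian_def conj_transpose_def transpose_def map_matrix_def vec_eq_iff)

lemma hermitian_congruence:
  "hermitian A \<Longrightarrow> hermitian (conj_transpose V ** A ** V)"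
  by (simp add: hermitian_def conj_transpose_mult matrix_mul_assoc)

lemma hermitian_gram: "hermitian (conj_transpose V ** V)"
  by (simp add: hermitian_def conj_transpose_mult)

lemma inner_imaginary_left: "inner (\<i> *s x) y = - inner x (\<i> *s y)"
  for x y :: "complex^'m"
  by (simp add: inner_vec_def inner_complex_def algebra_simps flip: sum_negf)

text \<open>Hermiticity of \<open>A\<close> and skewness of multiplication by \<open>\<i>\<close>
  make this value its own negative. It removes the Hamiltonian term from every energy
  derivative.\<close>

lemma inner_hermitian_imaginary:
  assumes "hermitian A"
  shows "inner x (A *v (\<i> *s x)) = 0"
  using hermitian_inner[OF assms, of x "\<i> *s x"] inner_imaginary_left[of x "A *v x"]
  by (simp add: vector_scalar_commute inner_commute)

text \<open>Rank \<open>CARD('m)\<close> means that the rows span the whole space, which yields a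
  left inverse.\<close>

lemma full_rank_imp_inj:
  fixes V :: "'a::field^'m^'n"
  assumes "rank V = CARD('m)"
  shows "inj ((*v) V)"
  using assms
  by (simp add: matrix_left_invertible_injective [symmetric] matrix_left_invertible_span_rows_gen
      row_rank_def_gen vec.dim_eq_full [symmetric] card_cart_basis vec.dimension_def)

lemma matrix_inv_mult_vector:
  assumes "invertible A"
  shows "matrix_inv A *v (A *v x) = x" "A *v (matrix_inv A *v x) = x"
  using someI_ex[OF assms[unfolded invertible_def]]
  by (simp_all add: matrix_inv_def matrix_vector_mul_assoc)

lemma invertible_iff_ker:
  fixes A :: "'a::field^'m^'m"
  shows "invertible A \<longleftrightarrow> (\<forall>x. A *v x = 0 \<longrightarrow> x = 0)"
  by (simp add: invertible_left_inverse matrix_left_invertible_ker)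

lemma complex_matrix_vector_mult_scaleR: "A *v (r *\<^sub>R x) = r *\<^sub>R (A *v x)"
  for A :: "complex^'m^'n"
  by (rule linear_simps(5)) simp

lemma matrix_vector_mult_minus: "A *v (- x) = - (A *v x)"
  for A :: "complex^'m^'n"
  by (rule linear_simps(4)) simp

section \<open>Elementary bounds for the spectral norm\<close>

lemma norm_mult_vector_le: "norm (A *v x) \<le> spectral_norm A * norm x"
  unfolding spectral_norm_def by (rule onorm) simp

lemma spectral_norm_nonneg: "0 \<le> spectral_norm A"
  unfolding spectral_norm_def by (rule onorm_pos_le) simp

lemma spectral_norm_le:
  assumes "\<And>x. norm (A *v x) \<le> b * norm x"
  shows "spectral_norm A \<le> b"
  unfolding spectral_norm_def using assms by (rule onorm_le)

section \<open>Perturbation of the generator\<close>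

text \<open>This takes the place of a Neumann series: a lower bound on \<open>1 + A\<close> is an
  upper bound on its inverse once the norm of \<open>A\<close> is below one.\<close>

lemma norm_add_contraction_ge:
  "(1 - spectral_norm A) * norm x \<le> norm (x + A *v x)"
  using norm_mult_vector_le[of A x] norm_triangle_ineq2[of x "- (A *v x)"]
  by (simp add: algebra_simps)

lemma spectral_norm_generator_diff_le:
  fixes S T \<Delta>S \<Delta>T :: "complex^'m^'m"
  assumes S: "invertible S" and q: "spectral_norm (matrix_inv S ** \<Delta>S) < 1"
  shows "invertible (S + \<Delta>S)"
    and "spectral_norm (matrix_inv (S + \<Delta>S) ** (T + \<Delta>T) - matrix_inv S ** T)
      \<le> spectral_norm (matrix_inv S) / (1 - spectral_norm (matrix_inv S ** \<Delta>S))
         * (spectral_norm \<Delta>T + spectral_norm \<Delta>S * spectral_norm (matrix_inv S ** T))"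
proof -
  let ?A = "matrix_inv S ** \<Delta>S" and ?G = "matrix_inv S ** T"
  \<comment> \<open>A norm estimate for the inverse of \<open>S + \<Delta>S\<close>, phrased without
    that inverse: it first gives a zero kernel, hence invertibility, and then bounds the difference
    of the generators.\<close>
  have bound: "norm x \<le> spectral_norm (matrix_inv S) / (1 - spectral_norm ?A)
      * norm ((S + \<Delta>S) *v x)" for x
  proof -
    have "x + ?A *v x = matrix_inv S *v ((S + \<Delta>S) *v x)"
      by (simp add: matrix_vector_mult_add_rdistrib matrix_vector_right_distrib
          matrix_inv_mult_vector[OF S] flip: matrix_vector_mul_assoc)
    then have "(1 - spectral_norm ?A) * norm x
        \<le> spectral_norm (matrix_inv S) * norm ((S + \<Delta>S) *v x)"
      using norm_add_contraction_ge[of ?A x] norm_mult_vector_le order_trans by metis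
    then show ?thesis
      using q by (simp add: field_simps)
  qed
  show inv: "invertible (S + \<Delta>S)"
    unfolding invertible_iff_ker
  proof (intro allI impI)
    fix x assume "(S + \<Delta>S) *v x = 0"
    with bound[of x] show "x = 0" by simp
  qed
  let ?D = "matrix_inv (S + \<Delta>S) ** (T + \<Delta>T) - ?G"
  show "spectral_norm ?D \<le> spectral_norm (matrix_inv S) / (1 - spectral_norm ?A)
         * (spectral_norm \<Delta>T + spectral_norm \<Delta>S * spectral_norm ?G)"
  proof (rule spectral_norm_le)
    fix x
    \<comment> \<open>Multiplying by \<open>S + \<Delta>S\<close> removes its inverse; then
      \<open>S *v (?G *v x) = T *v x\<close> cancels the unperturbed part.\<close>
    have "(S + \<Delta>S) *v (?D *v x) = (T + \<Delta>T) *v x - (S + \<Delta>S) *v (?G *v x)"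
      by (simp add: matrix_vector_mult_diff_rdistrib matrix_vector_mult_diff_distrib
          matrix_inv_mult_vector[OF inv] flip: matrix_vector_mul_assoc)
    also have "\<dots> = \<Delta>T *v x - \<Delta>S *v (?G *v x)"
      by (simp add: matrix_vector_mult_add_rdistrib
          matrix_inv_mult_vector[OF S] flip: matrix_vector_mul_assoc)
    finally have "norm ((S + \<Delta>S) *v (?D *v x)) \<le> norm (\<Delta>T *v x) + norm (\<Delta>S *v (?G *v x))"
      by (simp add: norm_triangle_ineq4)
    also have "norm (\<Delta>S *v (?G *v x)) \<le> spectral_norm \<Delta>S * (spectral_norm ?G * norm x)"
      using norm_mult_vector_le[of \<Delta>S "?G *v x"] norm_mult_vector_le[of ?G x]
        mult_left_mono[OF _ spectral_norm_nonneg[of \<Delta>S]] order_trans by blast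
    also note norm_mult_vector_le[of \<Delta>T x]
    finally have "norm ((S + \<Delta>S) *v (?D *v x))
        \<le> (spectral_norm \<Delta>T + spectral_norm \<Delta>S * spectral_norm ?G) * norm x"
      by (simp add: algebra_simps)
    then have "spectral_norm (matrix_inv S) / (1 - spectral_norm ?A)
        * norm ((S + \<Delta>S) *v (?D *v x)) \<le> spectral_norm (matrix_inv S) / (1 - spectral_norm ?A)
        * ((spectral_norm \<Delta>T + spectral_norm \<Delta>S * spectral_norm ?G) * norm x)"
      using q spectral_norm_nonneg[of "matrix_inv S"] by (intro mult_left_mono) simp_all
    with bound[of "?D *v x"]
    show "norm (?D *v x) \<le> spectral_norm (matrix_inv S) / (1 - spectral_norm ?A)
        * (spectral_norm \<Delta>T + spectral_norm \<Delta>S * spectral_norm ?G) * norm x"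
      by (simp add: mult.assoc)
  qed
qed

section \<open>The energy norm of a positive definite matrix\<close>

definition pos_def :: "complex^'m^'m \<Rightarrow> bool" where
  "pos_def S \<longleftrightarrow> hermitian S \<and> (\<forall>x. x \<noteq> 0 \<longrightarrow> 0 < inner x (S *v x))"

definition energy_norm :: "complex^'m^'m \<Rightarrow> complex^'m \<Rightarrow> real" where
  "energy_norm S x = sqrt (inner x (S *v x))"

lemma pos_def_hermitian: "pos_def S \<Longrightarrow> hermitian S"
  by (simp add: pos_def_def)

lemma pos_def_nonneg: "pos_def S \<Longrightarrow> 0 \<le> inner x (S *v x)"
  by (cases "x = 0") (auto simp: pos_def_def less_imp_le)

lemma energy_norm_nonneg: "pos_def S \<Longrightarrow> 0 \<le> energy_norm S x"
  by (simp add: energy_norm_def pos_def_nonneg)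

lemma energy_norm_pos: "pos_def S \<Longrightarrow> x \<noteq> 0 \<Longrightarrow> 0 < energy_norm S x"
  by (simp add: energy_norm_def pos_def_def)

lemma energy_norm_square: "pos_def S \<Longrightarrow> (energy_norm S x)\<^sup>2 = inner x (S *v x)"
  by (simp add: energy_norm_def pos_def_nonneg)

lemma pos_def_invertible:
  assumes "pos_def S"
  shows "invertible S"
  using assms unfolding invertible_iff_ker pos_def_def by (metis inner_zero_right less_irrefl)

lemma pos_def_gram:
  fixes V :: "complex^'m^'n"
  assumes "inj ((*v) V)"
  shows "pos_def (conj_transpose V ** V)"
  unfolding pos_def_def
proof (intro conjI allI impI hermitian_gram)
  fix x :: "complex^'m" assume "x \<noteq> 0"
  then have "V *v x \<noteq> 0"
    using injD[OF assms, of x 0] by auto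
  moreover have "inner x ((conj_transpose V ** V) *v x) = inner (V *v x) (V *v x)"
    by (simp add: inner_matrix_vector_mult[of x "conj_transpose V"] flip: matrix_vector_mul_assoc)
  ultimately show "0 < inner x ((conj_transpose V ** V) *v x)"
    by simp
qed

lemma energy_norm_imaginary: "energy_norm S (\<i> *s x) = energy_norm S x"
proof -
  have "\<i> *s (\<i> *s (S *v x)) = - (S *v x)"
    by (simp add: vec_eq_iff)
  then show ?thesis
    by (simp add: energy_norm_def inner_imaginary_left vector_scalar_commute)
qed

lemma energy_Cauchy_Schwarz:
  assumes S: "pos_def S"
  shows "\<bar>inner x (S *v y)\<bar> \<le> energy_norm S x * energy_norm S y"
proof (cases "y = 0")
  case True
  then show ?thesis by (simp add: energy_norm_def)
next
  case False
  let ?p = "inner y (S *v y)" and ?b = "inner x (S *v y)"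
  have p: "0 < ?p" using False S by (simp add: pos_def_def)
  \<comment> \<open>Up to the factor \<open>?p\<close>, this is the part of \<open>x\<close> that is
    energy-orthogonal to \<open>y\<close>.\<close>
  let ?z = "?p *\<^sub>R x - ?b *\<^sub>R y"
  have sym: "inner y (S *v x) = ?b"
    using hermitian_inner[OF pos_def_hermitian[OF S]] by (simp add: inner_commute)
  have "0 \<le> inner ?z (S *v ?z)"
    using S by (rule pos_def_nonneg)
  also have "\<dots> = ?p * (?p * inner x (S *v x) - ?b\<^sup>2)"
    unfolding matrix_vector_mult_diff_distrib complex_matrix_vector_mult_scaleR
      inner_diff_left inner_diff_right inner_scaleR_left inner_scaleR_right sym
    by algebra
  finally have "?b\<^sup>2 \<le> inner x (S *v x) * ?p"
    using p by (simp add: zero_le_mult_iff mult.commute)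
  then have "sqrt (?b\<^sup>2) \<le> sqrt (inner x (S *v x) * ?p)"
    by (rule real_sqrt_le_mono)
  then show ?thesis by (simp add: energy_norm_def real_sqrt_mult)
qed

lemma energy_norm_le: "energy_norm S x \<le> sqrt (spectral_norm S) * norm x"
proof -
  have "inner x (S *v x) \<le> norm x * norm (S *v x)"
    by (rule norm_cauchy_schwarz)
  also have "\<dots> \<le> norm x * (spectral_norm S * norm x)"
    by (intro mult_left_mono norm_mult_vector_le) simp
  finally have "sqrt (inner x (S *v x)) \<le> sqrt (spectral_norm S * (norm x)\<^sup>2)"
    by (intro real_sqrt_le_mono) (simp add: power2_eq_square algebra_simps)
  then show ?thesis by (simp add: energy_norm_def real_sqrt_mult)
qed

lemma norm_le_energy_norm:
  assumes S: "pos_def S"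
  shows "norm x \<le> sqrt (spectral_norm (matrix_inv S)) * energy_norm S x"
proof (cases "x = 0")
  case True
  then show ?thesis by (simp add: energy_norm_def)
next
  case False
  \<comment> \<open>Cauchy-Schwarz against \<open>?y\<close> produces
    \<open>(norm x)\<^sup>2\<close>, and the energy of \<open>?y\<close> under \<open>S\<close> is
    that of \<open>x\<close> under \<open>matrix_inv S\<close>; no matrix square root
    enters.\<close>
  let ?y = "matrix_inv S *v x"
  have Sy: "S *v ?y = x"
    by (rule matrix_inv_mult_vector[OF pos_def_invertible[OF S]])
  have "energy_norm S ?y \<le> sqrt (spectral_norm (matrix_inv S)) * norm x"
    using energy_norm_le[of "matrix_inv S" x] Sy by (simp add: energy_norm_def inner_commute)
  moreover have "(norm x)\<^sup>2 \<le> energy_norm S x * energy_norm S ?y"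
    using energy_Cauchy_Schwarz[OF S, of x ?y] Sy by (simp add: power2_norm_eq_inner)
  ultimately have "(norm x)\<^sup>2
      \<le> energy_norm S x * (sqrt (spectral_norm (matrix_inv S)) * norm x)"
    using mult_left_mono[OF _ energy_norm_nonneg[OF S, of x]] order_trans by blast
  then show ?thesis
    using False by (simp add: power2_eq_square mult_ac)
qed

section \<open>Stability of positive definiteness\<close>

text \<open>The matrix \<open>A = S\<^sup>-\<^sup>1 \<Delta>S\<close> is self-adjoint for the energy inner product, so the energy norms
  \<open>a k\<close> of \<open>A\<^sup>k x\<close> are log-convex. As they tend to \<open>0\<close>, they decrease from the start.\<close>

lemma energy_norm_contraction:
  fixes S \<Delta>S :: "complex^'m^'m"
  assumes S: "pos_def S" and \<Delta>S: "hermitian \<Delta>S"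
    and q: "spectral_norm (matrix_inv S ** \<Delta>S) < 1" and x: "x \<noteq> 0"
  shows "energy_norm S (matrix_inv S *v (\<Delta>S *v x)) < energy_norm S x"
proof (rule ccontr)
  define A where "A = (\<lambda>x. matrix_inv S *v (\<Delta>S *v x))"
  define a where "a k = energy_norm S ((A ^^ k) x)" for k
  let ?q = "spectral_norm (matrix_inv S ** \<Delta>S)"
  assume "\<not> ?thesis"
  then have "a 0 \<le> a 1" by (simp add: a_def A_def)
  have pos: "0 < a 0" using energy_norm_pos[OF S x] by (simp add: a_def)
  have SA: "S *v A w = \<Delta>S *v w" for w
    by (simp add: A_def matrix_inv_mult_vector[OF pos_def_invertible[OF S]])
  have log_convex: "(a (Suc k))\<^sup>2 \<le> a k * a (Suc (Suc k))" for k
  proof -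
    let ?w = "(A ^^ k) x"
    have "(a (Suc k))\<^sup>2 = inner (A ?w) (S *v A ?w)"
      by (simp add: a_def energy_norm_square[OF S])
    also have "\<dots> = inner ?w (S *v A (A ?w))"
      using hermitian_inner[OF \<Delta>S, of "A ?w" ?w] SA by (simp add: inner_commute)
    also have "\<dots> \<le> a k * a (Suc (Suc k))"
      using energy_Cauchy_Schwarz[OF S, of ?w "A (A ?w)"] by (simp add: a_def)
    finally show ?thesis .
  qed
  \<comment> \<open>Log-convexity carries \<open>a k \<le> a (Suc k)\<close> to the next index; the
    invariant \<open>a 0 \<le> a k\<close> keeps the cancelled factor positive.\<close>
  have mono: "a 0 \<le> a k \<and> a k \<le> a (Suc k)" for k
  proof (induction k)
    case 0
    then show ?case using \<open>a 0 \<le> a 1\<close> by simp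
  next
    case (Suc k)
    have "a (Suc k) * a (Suc k) \<le> a k * a (Suc (Suc k))"
      using log_convex[of k] by (simp add: power2_eq_square)
    also have "\<dots> \<le> a (Suc k) * a (Suc (Suc k))"
      using Suc.IH energy_norm_nonneg[OF S] by (intro mult_right_mono) (simp_all add: a_def)
    finally show ?case
      using Suc.IH pos by (auto simp: mult_le_cancel_left)
  qed
  have iter: "norm ((A ^^ k) x) \<le> ?q ^ k * norm x" for k
  proof (induction k)
    case (Suc k)
    have "norm (A ((A ^^ k) x)) \<le> ?q * norm ((A ^^ k) x)"
      using norm_mult_vector_le[of "matrix_inv S ** \<Delta>S" "(A ^^ k) x"]
      by (simp add: A_def matrix_vector_mul_assoc)
    also have "\<dots> \<le> ?q * (?q ^ k * norm x)"
      using Suc.IH spectral_norm_nonneg by (rule mult_left_mono)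
    finally show ?case by simp
  qed simp
  have "a 0 \<le> sqrt (spectral_norm S) * (?q ^ k * norm x)" for k
  proof -
    have "a 0 \<le> sqrt (spectral_norm S) * norm ((A ^^ k) x)"
      using mono[of k] energy_norm_le[of S "(A ^^ k) x"] by (simp add: a_def)
    also have "\<dots> \<le> sqrt (spectral_norm S) * (?q ^ k * norm x)"
      using iter by (intro mult_left_mono) (simp_all add: spectral_norm_nonneg)
    finally show ?thesis .
  qed
  moreover have "(\<lambda>k. sqrt (spectral_norm S) * (?q ^ k * norm x))
      \<longlonglongrightarrow> sqrt (spectral_norm S) * (0 * norm x)"
    using q spectral_norm_nonneg[of "matrix_inv S ** \<Delta>S"]
    by (intro tendsto_intros LIMSEQ_power_zero) simp
  ultimately have "a 0 \<le> 0"
    by (intro LIMSEQ_le_const) auto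
  with pos show False by simp
qed

text \<open>It suffices that \<open>inner x (\<Delta>S *v x)\<close> is smaller in absolute value
  than \<open>inner x (S *v x)\<close>. Cauchy-Schwarz reduces this to a contraction in the energy
  norm, whereas \<open>q\<close> is Euclidean; \<open>energy_norm_contraction\<close> bridges the
  two without losing a condition number.\<close>

lemma pos_def_perturbation:
  fixes S \<Delta>S :: "complex^'m^'m"
  assumes S: "pos_def S" and \<Delta>S: "hermitian \<Delta>S"
    and q: "spectral_norm (matrix_inv S ** \<Delta>S) < 1"
  shows "pos_def (S + \<Delta>S)"
  unfolding pos_def_def
proof (intro conjI allI impI hermitian_add pos_def_hermitian[OF S] \<Delta>S)
  fix x :: "complex^'m" assume x: "x \<noteq> 0"
  let ?y = "matrix_inv S *v (\<Delta>S *v x)"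
  have "\<bar>inner x (\<Delta>S *v x)\<bar> \<le> energy_norm S x * energy_norm S ?y"
    using energy_Cauchy_Schwarz[OF S, of x ?y]
    by (simp add: matrix_inv_mult_vector[OF pos_def_invertible[OF S]])
  also have "\<dots> < energy_norm S x * energy_norm S x"
    using energy_norm_contraction[OF S \<Delta>S q x] energy_norm_pos[OF S x] by simp
  also have "\<dots> = inner x (S *v x)"
    using energy_norm_square[OF S] by (simp add: power2_eq_square)
  finally show "0 < inner x ((S + \<Delta>S) *v x)"
    by (simp add: matrix_vector_mult_add_rdistrib inner_add_right)
qed

section \<open>Evolution in the energy norm\<close>

lemma has_real_derivative_energy:
  assumes S: "hermitian S" and e: "(e has_vector_derivative e') (at t within X)"
  shows "((\<lambda>t. inner (e t) (S *v e t)) has_real_derivative 2 * inner (e t) (S *v e')) (at t within X)"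
proof -
  note e' = e[unfolded has_vector_derivative_def]
  have "((\<lambda>t. inner (e t) (S *v e t)) has_derivative
      (\<lambda>h. inner (e t) (S *v (h *\<^sub>R e')) + inner (h *\<^sub>R e') (S *v e t))) (at t within X)"
    by (intro has_derivative_inner bounded_linear.has_derivative[OF matrix_vector_mul_bounded_linear] e')
  \<comment> \<open>Hermiticity merges the two terms of the product rule into the factor 2.\<close>
  moreover have "inner (e t) (S *v (h *\<^sub>R e')) + inner (h *\<^sub>R e') (S *v e t)
      = 2 * inner (e t) (S *v e') * h" for h
    using hermitian_inner[OF S, of "e t" e']
    by (simp add: complex_matrix_vector_mult_scaleR inner_commute)
  ultimately show ?thesis
    by (simp add: has_field_derivative_def)
qed

lemma evolves_under_imp:
  assumes "evolves_under A c" "0 \<le> t"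
  shows "(c has_vector_derivative - (\<i> *s (A *v c t))) (at t within {0..})"
proof -
  obtain c' where c': "(c has_vector_derivative c') (at t within {0..})" "\<i> *s c' = A *v c t"
    using assms by (auto simp: evolves_under_def)
  have "- (\<i> *s (\<i> *s c')) = c'"
    by (simp add: vec_eq_iff)
  with c' show ?thesis by simp
qed

text \<open>Since \<^term>\<open>energy_norm S\<close> is not differentiable at \<open>0\<close>, the proof estimates the
  derivative of the square root of the regularised energy \<open>f + \<epsilon>\<^sup>2\<close>.\<close>

lemma energy_norm_forced_le:
  fixes S T :: "complex^'m^'m"
  assumes S: "pos_def S" and T: "hermitian T" and "0 \<le> t" and "e 0 = 0"
    and e: "\<And>s. 0 \<le> s \<Longrightarrow>
      (e has_vector_derivative - (\<i> *s (matrix_inv S *v (T *v e s) + r s))) (at s within {0..})"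
    and r: "\<And>s. 0 \<le> s \<Longrightarrow> energy_norm S (r s) \<le> K"
  shows "energy_norm S (e t) \<le> K * t"
proof (rule field_le_epsilon)
  fix \<epsilon> :: real assume \<epsilon>: "0 < \<epsilon>"
  define f where "f s = inner (e s) (S *v e s)" for s
  have f_nonneg: "0 \<le> f s" for s by (simp add: f_def pos_def_nonneg[OF S])
  have K: "0 \<le> K" using r[of 0] energy_norm_nonneg[OF S, of "r 0"] by simp
  define f' where "f' s = - 2 * inner (e s) (S *v (\<i> *s r s))" for s
  have f: "(f has_real_derivative f' s) (at s within {0..})" if "0 \<le> s" for s
  proof -
    \<comment> \<open>\<open>S\<close> cancels its inverse, so the homogeneous term becomes
      \<open>inner (e s) (T *v (\<i> *s e s))\<close>, which vanishes; only the forcing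
      \<open>r\<close> contributes to \<open>f'\<close>.\<close>
    have "inner (e s) (S *v - (\<i> *s (matrix_inv S *v (T *v e s) + r s)))
        = - inner (e s) (T *v (\<i> *s e s)) - inner (e s) (S *v (\<i> *s r s))"
      by (simp add: vector_scalar_commute vector_add_ldistrib matrix_vector_right_distrib inner_add_right
          matrix_vector_mult_diff_distrib inner_diff_right
          matrix_inv_mult_vector[OF pos_def_invertible[OF S]] matrix_vector_mult_minus)
    then show ?thesis
      using has_real_derivative_energy[OF pos_def_hermitian[OF S] e[OF that]]
        inner_hermitian_imaginary[OF T]
      by (simp add: f_def [abs_def] f'_def)
  qed
  have f'_le: "f' s \<le> 2 * K * sqrt (f s + \<epsilon>\<^sup>2)" if "0 \<le> s" for s
  proof -
    have "\<bar>inner (e s) (S *v (\<i> *s r s))\<bar> \<le> energy_norm S (e s) * energy_norm S (r s)"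
      using energy_Cauchy_Schwarz[OF S, of "e s" "\<i> *s r s"] by (simp only: energy_norm_imaginary)
    also have "\<dots> \<le> energy_norm S (e s) * K"
      by (rule mult_left_mono[OF r[OF that] energy_norm_nonneg[OF S]])
    also have "\<dots> \<le> sqrt (f s + \<epsilon>\<^sup>2) * K"
      using K by (intro mult_right_mono) (simp_all add: energy_norm_def f_def)
    finally have "- inner (e s) (S *v (\<i> *s r s)) \<le> sqrt (f s + \<epsilon>\<^sup>2) * K"
      by linarith
    then show ?thesis unfolding f'_def by argo
  qed
  \<comment> \<open>By \<open>f'_le\<close> the slope of \<open>g\<close> is at most
    \<open>K\<close>; \<open>g\<close> starts at \<open>\<epsilon>\<close> because
    \<open>e 0 = 0\<close>, and it dominates the energy norm.\<close>
  define g where "g s = sqrt (f s + \<epsilon>\<^sup>2)" for s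
  have pos: "0 < f s + \<epsilon>\<^sup>2" for s
    using f_nonneg[of s] \<epsilon> by (simp add: add_nonneg_pos)
  have g: "(g has_real_derivative f' s / (2 * g s)) (at s within {0..})" if "0 \<le> s" for s
    unfolding g_def using pos[of s] f[OF that]
    by (auto intro!: derivative_eq_intros simp: field_simps)
  have g_pos: "0 < g s" for s using pos by (simp add: g_def)
  have "g t - g 0 \<le> K * t"
  proof (cases "t = 0")
    case False
    then have "0 < t" using \<open>0 \<le> t\<close> by simp
    have "\<exists>s\<in>{0<..<t}. g t - g 0 = f' s / (2 * g s) * (t - 0)"
    proof (rule mvt_simple[OF \<open>0 < t\<close>])
      fix s assume s: "0 \<le> s" "s \<le> t"
      show "(g has_derivative (*) (f' s / (2 * g s))) (at s within {0..t})"
        using has_field_derivative_subset[OF g[OF s(1)], of "{0..t}"]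
        by (auto simp: has_field_derivative_def)
    qed
    then obtain s where s: "0 < s" "g t - g 0 = f' s / (2 * g s) * t" by auto
    have "f' s / (2 * g s) * t \<le> K * t"
      using \<open>0 \<le> t\<close>
    proof (rule mult_right_mono[rotated])
      show "f' s / (2 * g s) \<le> K"
        using f'_le[of s] g_pos[of s] s by (simp add: g_def field_simps)
    qed
    with s(2) show ?thesis by (simp only:)
  qed simp
  moreover have "g 0 = \<epsilon>" using \<epsilon> by (simp add: g_def f_def \<open>e 0 = 0\<close>)
  moreover have "energy_norm S (e t) \<le> g t" by (simp add: energy_norm_def g_def f_def)
  ultimately show "energy_norm S (e t) \<le> K * t + \<epsilon>" by simp
qed

lemma energy_norm_conserved:
  fixes S T :: "complex^'m^'m"
  assumes S: "pos_def S" and T: "hermitian T" and "0 \<le> t"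
    and c: "evolves_under (matrix_inv S ** T) c"
  shows "energy_norm S (c t) = energy_norm S (c 0)"
proof -
  have "((\<lambda>t. inner (c t) (S *v c t)) has_real_derivative 0) (at s within {0..})" if "0 \<le> s" for s
  proof -
    have "inner (c s) (S *v - (\<i> *s ((matrix_inv S ** T) *v c s))) = - inner (c s) (T *v (\<i> *s c s))"
      by (simp add: vector_scalar_commute matrix_vector_mult_minus
          matrix_inv_mult_vector[OF pos_def_invertible[OF S]] flip: matrix_vector_mul_assoc)
    then show ?thesis
      using has_real_derivative_energy[OF pos_def_hermitian[OF S] evolves_under_imp[OF c that]]
        inner_hermitian_imaginary[OF T] by simp
  qed
  then obtain k where "\<And>s. s \<in> {0..} \<Longrightarrow> inner (c s) (S *v c s) = k"
    using has_field_derivative_zero_constant[of "{0..}" "\<lambda>s. inner (c s) (S *v c s)"] by auto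
  then have "inner (c t) (S *v c t) = inner (c 0) (S *v c 0)"
    using \<open>0 \<le> t\<close> by simp
  then show ?thesis by (simp add: energy_norm_def)
qed

section \<open>Euclidean bounds for the evolutions\<close>

lemma norm_evolution_le:
  assumes S: "pos_def S" and T: "hermitian T" and "0 \<le> t"
    and c: "evolves_under (matrix_inv S ** T) c"
  shows "norm (c t) \<le> sqrt (spectral_cond S) * norm (c 0)"
proof -
  \<comment> \<open>The energy norm is constant in time; only leaving it at time \<open>t\<close>
    and entering it at time \<open>0\<close> costs factors, with product
    \<open>sqrt (spectral_cond S)\<close>.\<close>
  have "norm (c t) \<le> sqrt (spectral_norm (matrix_inv S)) * energy_norm S (c 0)"
    using norm_le_energy_norm[OF S, of "c t"] energy_norm_conserved[OF assms] by simp
  also have "\<dots> \<le> sqrt (spectral_norm (matrix_inv S)) * (sqrt (spectral_norm S) * norm (c 0))"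
    by (intro mult_left_mono energy_norm_le) (simp add: spectral_norm_nonneg)
  finally show ?thesis
    by (simp add: spectral_cond_def real_sqrt_mult mult_ac)
qed

text \<open>The solution \<open>c\<close> is controlled through the energy of \<open>S\<close> and
  the error through that of \<open>R\<close>, so each condition number enters once.\<close>

lemma norm_evolution_diff_le:
  fixes S T R U :: "complex^'m^'m"
  defines "G \<equiv> matrix_inv S ** T" and "F \<equiv> matrix_inv R ** U"
  assumes S: "pos_def S" and T: "hermitian T" and R: "pos_def R" and U: "hermitian U"
    and c: "evolves_under G c" and d: "evolves_under F d" and init: "d 0 = c 0" and t: "0 \<le> t"
  shows "norm (d t - c t)
    \<le> t * sqrt (spectral_cond S * spectral_cond R) * spectral_norm (F - G) * norm (c 0)"
proof -
  define r where "r s = (F - G) *v c s" for s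
  define N where "N = spectral_norm (F - G) * (sqrt (spectral_cond S) * norm (c 0))"
  have deriv: "((\<lambda>s. d s - c s) has_vector_derivative
      - (\<i> *s (matrix_inv R *v (U *v (d s - c s)) + r s))) (at s within {0..})" if "0 \<le> s" for s
  proof -
    \<comment> \<open>Splitting \<open>F d - G c\<close> as \<open>F (d - c) + (F - G) c\<close>
      puts the unperturbed solution into the forcing, where \<open>norm_evolution_le\<close> bounds
      it uniformly in time.\<close>
    have "- (\<i> *s (F *v d s)) - - (\<i> *s (G *v c s)) = - (\<i> *s (F *v (d s - c s) + r s))"
      by (simp add: r_def vec_eq_iff matrix_vector_mult_diff_distrib
          matrix_vector_mult_diff_rdistrib algebra_simps)
    then show ?thesis
      using has_vector_derivative_diff[OF evolves_under_imp[OF d that] evolves_under_imp[OF c that]]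
      by (simp add: F_def matrix_vector_mul_assoc)
  qed
  have "energy_norm R (r s) \<le> sqrt (spectral_norm R) * N" if "0 \<le> s" for s
  proof -
    have "norm (r s) \<le> spectral_norm (F - G) * norm (c s)"
      unfolding r_def by (rule norm_mult_vector_le)
    also have "\<dots> \<le> N"
      unfolding N_def using norm_evolution_le[OF S T that] c
      by (intro mult_left_mono) (simp_all add: G_def spectral_norm_nonneg)
    finally have "sqrt (spectral_norm R) * norm (r s) \<le> sqrt (spectral_norm R) * N"
      by (intro mult_left_mono) (simp_all add: spectral_norm_nonneg)
    with energy_norm_le[of R "r s"] show ?thesis by simp
  qed
  then have "energy_norm R (d t - c t) \<le> sqrt (spectral_norm R) * N * t"
    using energy_norm_forced_le[OF R U t _ deriv] init by simp
  then have "norm (d t - c t)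
      \<le> sqrt (spectral_norm (matrix_inv R)) * (sqrt (spectral_norm R) * N * t)"
    using norm_le_energy_norm[OF R, of "d t - c t"]
      mult_left_mono[of _ _ "sqrt (spectral_norm (matrix_inv R))"]
    by (meson order_trans real_sqrt_ge_zero spectral_norm_nonneg)
  then show ?thesis
    by (simp add: N_def spectral_cond_def real_sqrt_mult mult_ac)
qed

text \<open>Hermitian errors keep \<open>Ghat\<close> self-adjoint for the energy product of
  \<open>Shat\<close>. For general errors the second bound fails: in dimension one with
  \<open>V = 1\<close>, \<open>H = 0\<close>, \<open>\<Delta>S = 0\<close>,
  \<open>\<Delta>H = \<i>\<close> and \<open>c 0 = 1\<close>, the difference is
  \<open>exp t - 1\<close>, which exceeds \<open>t\<close> for \<open>t > 0\<close>.\<close>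

theorem proposition1:
  fixes H :: "complex^'n^'n"
    and V :: "complex^'m^'n"
    and S HK \<Delta>S \<Delta>H Shat HKhat G Ghat :: "complex^'m^'m"
  assumes "hermitian H"
    and "rank V = CARD('m)"
    and "S = conj_transpose V ** V"
    and "HK = conj_transpose V ** H ** V"
    and "Shat = S + \<Delta>S"
    and "HKhat = HK + \<Delta>H"
    and "G = matrix_inv S ** HK"
    and "Ghat = matrix_inv Shat ** HKhat"
    and "spectral_norm (matrix_inv S ** \<Delta>S) < 1"
  shows "spectral_norm (Ghat - G)
           \<le> spectral_norm (matrix_inv S) / (1 - spectral_norm (matrix_inv S ** \<Delta>S))
              * (spectral_norm \<Delta>H + spectral_norm \<Delta>S * spectral_norm G)
       \<and> (hermitian \<Delta>S \<and> hermitian \<Delta>H \<longrightarrow>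
           (\<forall>c chat :: real \<Rightarrow> complex^'m.
              evolves_under G c \<and> evolves_under Ghat chat \<and> chat 0 = c 0 \<longrightarrow>
                (\<forall>t\<ge>0. norm (chat t - c t)
                   \<le> t * sqrt (spectral_cond S * spectral_cond Shat)
                      * spectral_norm (Ghat - G) * norm (c 0))))"
proof -
  have S: "pos_def S"
    using pos_def_gram full_rank_imp_inj assms(2,3) by blast
  have HK: "hermitian HK"
    using hermitian_congruence assms(1,4) by blast
  show ?thesis
  proof (intro conjI impI allI)
    show "spectral_norm (Ghat - G)
        \<le> spectral_norm (matrix_inv S) / (1 - spectral_norm (matrix_inv S ** \<Delta>S))
          * (spectral_norm \<Delta>H + spectral_norm \<Delta>S * spectral_norm G)"
      using spectral_norm_generator_diff_le(2)[OF pos_def_invertible[OF S] assms(9)] assms(5-8)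
      by simp
  next
    fix c chat :: "real \<Rightarrow> complex^'m" and t :: real
    assume herm: "hermitian \<Delta>S \<and> hermitian \<Delta>H"
      and evol: "evolves_under G c \<and> evolves_under Ghat chat \<and> chat 0 = c 0" and t: "0 \<le> t"
    have "pos_def Shat"
      using pos_def_perturbation[OF S] herm assms(5,9) by simp
    moreover have "hermitian HKhat"
      using hermitian_add[OF HK] herm assms(6) by simp
    ultimately show "norm (chat t - c t) \<le> t * sqrt (spectral_cond S * spectral_cond Shat)
        * spectral_norm (Ghat - G) * norm (c 0)"
      using norm_evolution_diff_le[OF S HK] evol t assms(7,8) by simp
  qed
qed

end
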